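(* Let $(\mathfrak{g},[\cdot,\cdot])$ be a Leibniz algebra, $(V,\rho^L,\rho^R)$ a representation of it, $H:\mathfrak{g}\otimes\mathfrak{g}\to V$ a $2$-cocycle of $\mathfrak{g}$ with coefficients in $V$, and $K:V\to\mathfrak{g}$ an $H$-twisted relative Rota-Baxter operator. Then the infinitesimal $K_1$ of any formal deformation $K_t=\sum_{i\ge 0}K_it^i$ of $K$ is a $1$-cocycle in the cohomology of $K$ (that is, $\partial_K(K_1)=0$), and the corresponding cohomology class in $H^1(V,\mathfrak{g})$ depends only on the equivalence class of the deformation; i.e. the infinitesimals of equivalent formal deformations of $K$ have the same class in $H^1(V,\mathfrak{g})$.
   Context: All vector spaces are finite-dimensional over $\mathbb{C}$ (apart from spaces of formal power series). A Leibniz algebra is a vector space $\mathfrak{g}$ with a bilinear bracket satisfying $[x,[y,z]]=[[x,y],z]+[y,[x,z]]$ for all $x,y,z\in\mathfrak{g}$. A representation of $\mathfrak{g}$ is a triple $(V,\rho^L,\rho^R)$ with $V$ a vector space and linear maps $\rho^L,\rho^R:\mathfrak{g}\to gl(V)$ such that for all $x,y\in\mathfrak{g}$: $\rho^L([x,y])=\rho^L(x)\rho^L(y)-\rho^L(y)\rho^L(x)$, $\rho^R([x,y])=\rho^L(x)\rho^R(y)-\rho^R(y)\rho^L(x)$, and $\rho^R([x,y])=\rho^L(x)\rho^R(y)+\rho^R(y)\rho^R(x)$. A $2$-cocycle of $\mathfrak{g}$ with coefficients in $V$ is a bilinear map $H:\mathfrak{g}\otimes\mathfrak{g}\to V$ with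 $\rho^L(x)H(y,z)-\rho^L(y)H(x,z)-\rho^R(z)H(x,y)-H([x,y],z)-H(y,[x,z])+H(x,[y,z])=0$ for all $x,y,z\in\mathfrak{g}$. A linear map $K:V\to\mathfrak{g}$ is an $H$-twisted relative Rota-Baxter operator if $[Ku,Kv]=K(\rho^L(Ku)v+\rho^R(Kv)u+H(Ku,Kv))$ for all $u,v\in V$. Cohomology of $K$: $V$ is a Leibniz algebra with bracket $[u,v]_K=\rho^L(Ku)v+\rho^R(Kv)u+H(Ku,Kv)$, and it has a representation on $\mathfrak{g}$ given by $\overline{\rho}^L(u)x=[Ku,x]-K(\rho^R(x)u)-KH(Ku,x)$, $\overline{\rho}^R(u)x=[x,Ku]-K(\rho^L(x)u)-KH(x,Ku)$. Set $C^n(V,\mathfrak{g})=\mathrm{Hom}(V^{\otimes n},\mathfrak{g})$ ($n\ge0$), with differential $\partial_K:C^n\to C^{n+1}$, $$(\partial_Kf)(u_1,\dots,u_{n+1})=\sum_{i=1}^n(-1)^{i+1}\overline{\rho}^L(u_i)f(u_1,\dots,\hat u_i,\dots,u_{n+1})+(-1)^{n+1}\overline{\rho}^R(u_{n+1})f(u_1,\dots,u_n)+\sum_{1\le i<j\le n+1}(-1)^if(u_1,\dots,\hat u_i,\dots,u_{j-1},[u_i,u_j]_K,u_{j+1},\dots,u_{n+1}).$$ In particular, for $x\in\mathfrak{g}=C^0$, $(\partial_Kx)(u)=-\overline{\rho}^R(u)x$. Put $Z^n(V,\mathfrak{g})=\ker(\partial_K|_{C^n})$, $B^n(V,\mathfrak{g})=\partial_K(C^{n-1})$,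 $H^n(V,\mathfrak{g})=Z^n/B^n$; elements of $Z^n(V,\mathfrak{g})$ are called $n$-cocycles in the cohomology of $K$. The bracket of $\mathfrak{g}$, the maps $\rho^L,\rho^R$ and $H$ are extended $\mathbb{C}[[t]]$-bilinearly to $\mathfrak{g}[[t]]$ and $V[[t]]$. A formal deformation of $K$ is a formal sum $K_t=\sum_{i\ge0}K_it^i$ with $K_i\in\mathrm{Hom}(V,\mathfrak{g})$, $K_0=K$ (extended $\mathbb{C}[[t]]$-linearly to $V[[t]]\to\mathfrak{g}[[t]]$), with $[K_tu,K_tv]=K_t(\rho^L(K_tu)v+\rho^R(K_tv)u+H(K_tu,K_tv))$ for all $u,v\in V$. Its infinitesimal is $K_1$. Two formal deformations $K_t,K'_t$ of $K$ are equivalent if there exist $x\in\mathfrak{g}$ and linear maps $\phi_i\in gl(\mathfrak{g})$, $\psi_i\in gl(V)$ ($i\ge2$) such that, with $\phi_t=\mathrm{Id}_{\mathfrak{g}}+t[x,\cdot]+\sum_{i\ge2}\phi_it^i$ and $\psi_t=\mathrm{Id}_V+t(\rho^L(x)+H(x,K(\cdot)))+\sum_{i\ge2}\psi_it^i$ (extended $\mathbb{C}[[t]]$-linearly), the pair $(\phi_t,\psi_t)$ is a morphism of $H$-twisted relative Rota-Baxter operators from $K_t$ to $K'_t$, meaning: $\phi_t$ is a Leibniz algebra morphism of $\mathfrak{g}[[t]]$, $\phi_t\circ K_t=K'_t\circ\psi_t$, $\psi_t(\rho^L(y)u)=\rho^L(\phi_t(y))\psi_t(u)$, $\psi_t(\rho^R(y)u)=\rho^R(\phi_t(y))\psi_t(u)$,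 and $\psi_t\circ H=H\circ(\phi_t\otimes\phi_t)$, for all $y\in\mathfrak{g}$, $u\in V$. *)

theory Defs
  imports Complex_Main "HOL-Computational_Algebra.Formal_Power_Series"
begin

text \<open>
  Vector spaces are types of class \<^class>\<open>ab_group_add\<close> with an explicit complex scalar
  multiplication; finite-dimensionality is the library locale
  \<^locale>\<open>finite_dimensional_vector_space\<close>, whose second parameter is a (finite) basis.
  A linear map \<open>\<g> \<rightarrow> gl(V)\<close> is given in uncurried form, as a bilinear map \<open>\<g> \<times> V \<rightarrow> V\<close>, and
  a linear map on \<open>\<g> \<otimes> \<g>\<close> as a bilinear map.
\<close>

definition bilinear_map ::
  "(complex \<Rightarrow> 'a::ab_group_add \<Rightarrow> 'a) \<Rightarrow> (complex \<Rightarrow> 'b::ab_group_add \<Rightarrow> 'b) \<Rightarrow>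
   (complex \<Rightarrow> 'c::ab_group_add \<Rightarrow> 'c) \<Rightarrow> ('a \<Rightarrow> 'b \<Rightarrow> 'c) \<Rightarrow> bool" where
  "bilinear_map sA sB sC b \<longleftrightarrow>
     (\<forall>x. Vector_Spaces.linear sB sC (\<lambda>y. b x y)) \<and>
     (\<forall>y. Vector_Spaces.linear sA sC (\<lambda>x. b x y))"


section \<open>Leibniz algebras, representations, cocycles, operators\<close>

locale leibniz_algebra = finite_dimensional_vector_space sg basisG
  for sg :: "complex \<Rightarrow> 'g::ab_group_add \<Rightarrow> 'g" and basisG :: "'g set" +
  fixes br :: "'g \<Rightarrow> 'g \<Rightarrow> 'g"
  assumes br_bilinear: "bilinear_map sg sg sg br"
    and leibniz: "br x (br y z) = br (br x y) z + br y (br x z)"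

locale leibniz_representation =
  leibniz_algebra sg basisG br + V: finite_dimensional_vector_space sv basisV
  for sg :: "complex \<Rightarrow> 'g::ab_group_add \<Rightarrow> 'g" and basisG :: "'g set"
    and br :: "'g \<Rightarrow> 'g \<Rightarrow> 'g"
    and sv :: "complex \<Rightarrow> 'v::ab_group_add \<Rightarrow> 'v" and basisV :: "'v set" +
  fixes rhoL rhoR :: "'g \<Rightarrow> 'v \<Rightarrow> 'v"
  assumes rhoL_bilinear: "bilinear_map sg sv sv rhoL"
    and rhoR_bilinear: "bilinear_map sg sv sv rhoR"
    and rhoL_br: "rhoL (br x y) v = rhoL x (rhoL y v) - rhoL y (rhoL x v)"
    and rhoR_br: "rhoR (br x y) v = rhoL x (rhoR y v) - rhoR y (rhoL x v)"
    and rhoR_br': "rhoR (br x y) v = rhoL x (rhoR y v) + rhoR y (rhoR x v)"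

locale leibniz_2_cocycle = leibniz_representation sg basisG br sv basisV rhoL rhoR
  for sg :: "complex \<Rightarrow> 'g::ab_group_add \<Rightarrow> 'g" and basisG :: "'g set"
    and br :: "'g \<Rightarrow> 'g \<Rightarrow> 'g"
    and sv :: "complex \<Rightarrow> 'v::ab_group_add \<Rightarrow> 'v" and basisV :: "'v set"
    and rhoL rhoR :: "'g \<Rightarrow> 'v \<Rightarrow> 'v" +
  fixes H :: "'g \<Rightarrow> 'g \<Rightarrow> 'v"
  assumes H_bilinear: "bilinear_map sg sg sv H"
    and H_cocycle:
      "rhoL x (H y z) - rhoL y (H x z) - rhoR z (H x y)
         - H (br x y) z - H y (br x z) + H x (br y z) = 0"

locale twisted_rota_baxter = leibniz_2_cocycle sg basisG br sv basisV rhoL rhoR H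
  for sg :: "complex \<Rightarrow> 'g::ab_group_add \<Rightarrow> 'g" and basisG :: "'g set"
    and br :: "'g \<Rightarrow> 'g \<Rightarrow> 'g"
    and sv :: "complex \<Rightarrow> 'v::ab_group_add \<Rightarrow> 'v" and basisV :: "'v set"
    and rhoL rhoR :: "'g \<Rightarrow> 'v \<Rightarrow> 'v" and H :: "'g \<Rightarrow> 'g \<Rightarrow> 'v" +
  fixes K :: "'v \<Rightarrow> 'g"
  assumes K_linear: "Vector_Spaces.linear sv sg K"
    and K_twisted_rb: "br (K u) (K v) = K (rhoL (K u) v + rhoR (K v) u + H (K u) (K v))"


section \<open>Cohomology of a Leibniz algebra with coefficients in a representation\<close>

text \<open>
  An \<open>n\<close>-cochain \<open>f : A\<^sup>\<otimes>\<^sup>n \<rightarrow> M\<close> is a function on lists, multilinear on the lists of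
  length \<open>n\<close> and \<open>0\<close> on all others, so that equality of cochains is equality of functions.
\<close>

definition cochains ::
  "(complex \<Rightarrow> 'a::ab_group_add \<Rightarrow> 'a) \<Rightarrow> (complex \<Rightarrow> 'm::ab_group_add \<Rightarrow> 'm) \<Rightarrow>
   nat \<Rightarrow> ('a list \<Rightarrow> 'm) set" where
  "cochains sA sM n = {f.
     (\<forall>us. length us \<noteq> n \<longrightarrow> f us = 0) \<and>
     (\<forall>us i. length us = n \<and> i < n \<longrightarrow> Vector_Spaces.linear sA sM (\<lambda>u. f (us[i := u])))}"

definition omit :: "nat \<Rightarrow> 'a list \<Rightarrow> 'a list" where
  "omit i us = take i us @ drop (Suc i) us"

text \<open>
  The entries \<open>u\<^sub>1, \<dots>, u\<^sub>n\<^sub>+\<^sub>1\<close> are \<open>us ! 0, \<dots>, us ! n\<close>: with \<open>i\<close> counted from \<open>0\<close>, the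
  customary signs \<open>(-1)\<^sup>i\<^sup>+\<^sup>1\<close> and \<open>(-1)\<^sup>i\<close> become \<open>(-1)\<^sup>i\<close> and \<open>(-1)\<^sup>i\<^sup>+\<^sup>1\<close> respectively.
\<close>

definition leibniz_d ::
  "(complex \<Rightarrow> 'm::ab_group_add \<Rightarrow> 'm) \<Rightarrow> ('a \<Rightarrow> 'a \<Rightarrow> 'a) \<Rightarrow> ('a \<Rightarrow> 'm \<Rightarrow> 'm) \<Rightarrow> ('a \<Rightarrow> 'm \<Rightarrow> 'm) \<Rightarrow>
   nat \<Rightarrow> ('a list \<Rightarrow> 'm) \<Rightarrow> ('a list \<Rightarrow> 'm)" where
  "leibniz_d sM brA rL rR n f = (\<lambda>us. if length us = Suc n then
       (\<Sum>i<n. sM ((-1) ^ i) (rL (us ! i) (f (omit i us))))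
     + sM ((-1) ^ Suc n) (rR (us ! n) (f (omit n us)))
     + (\<Sum>j\<le>n. \<Sum>i<j. sM ((-1) ^ Suc i) (f (omit i (us[j := brA (us ! i) (us ! j)]))))
     else 0)"


section \<open>Cohomology of a twisted relative Rota-Baxter operator\<close>

definition br_K ::
  "('g \<Rightarrow> 'v::ab_group_add \<Rightarrow> 'v) \<Rightarrow> ('g \<Rightarrow> 'v \<Rightarrow> 'v) \<Rightarrow> ('g \<Rightarrow> 'g \<Rightarrow> 'v) \<Rightarrow> ('v \<Rightarrow> 'g) \<Rightarrow>
   'v \<Rightarrow> 'v \<Rightarrow> 'v" where
  "br_K rhoL rhoR H K u v = rhoL (K u) v + rhoR (K v) u + H (K u) (K v)"

definition rhoL_K ::
  "('g \<Rightarrow> 'g \<Rightarrow> 'g::ab_group_add) \<Rightarrow> ('g \<Rightarrow> 'v \<Rightarrow> 'v) \<Rightarrow> ('g \<Rightarrow> 'g \<Rightarrow> 'v) \<Rightarrow> ('v \<Rightarrow> 'g) \<Rightarrow>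
   'v \<Rightarrow> 'g \<Rightarrow> 'g" where
  "rhoL_K br rhoR H K u x = br (K u) x - K (rhoR x u) - K (H (K u) x)"

definition rhoR_K ::
  "('g \<Rightarrow> 'g \<Rightarrow> 'g::ab_group_add) \<Rightarrow> ('g \<Rightarrow> 'v \<Rightarrow> 'v) \<Rightarrow> ('g \<Rightarrow> 'g \<Rightarrow> 'v) \<Rightarrow> ('v \<Rightarrow> 'g) \<Rightarrow>
   'v \<Rightarrow> 'g \<Rightarrow> 'g" where
  "rhoR_K br rhoL H K u x = br x (K u) - K (rhoL x u) - K (H x (K u))"

definition d_K ::
  "(complex \<Rightarrow> 'g::ab_group_add \<Rightarrow> 'g) \<Rightarrow> ('g \<Rightarrow> 'g \<Rightarrow> 'g) \<Rightarrow>
   ('g \<Rightarrow> 'v::ab_group_add \<Rightarrow> 'v) \<Rightarrow> ('g \<Rightarrow> 'v \<Rightarrow> 'v) \<Rightarrow> ('g \<Rightarrow> 'g \<Rightarrow> 'v) \<Rightarrow> ('v \<Rightarrow> 'g) \<Rightarrow>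
   nat \<Rightarrow> ('v list \<Rightarrow> 'g) \<Rightarrow> ('v list \<Rightarrow> 'g)" where
  "d_K sg br rhoL rhoR H K =
     leibniz_d sg (br_K rhoL rhoR H K) (rhoL_K br rhoR H K) (rhoR_K br rhoL H K)"

definition Z_K ::
  "(complex \<Rightarrow> 'g::ab_group_add \<Rightarrow> 'g) \<Rightarrow> ('g \<Rightarrow> 'g \<Rightarrow> 'g) \<Rightarrow>
   (complex \<Rightarrow> 'v::ab_group_add \<Rightarrow> 'v) \<Rightarrow> ('g \<Rightarrow> 'v \<Rightarrow> 'v) \<Rightarrow> ('g \<Rightarrow> 'v \<Rightarrow> 'v) \<Rightarrow>
   ('g \<Rightarrow> 'g \<Rightarrow> 'v) \<Rightarrow> ('v \<Rightarrow> 'g) \<Rightarrow> nat \<Rightarrow> ('v list \<Rightarrow> 'g) set" where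
  "Z_K sg br sv rhoL rhoR H K n =
     {f \<in> cochains sv sg n. d_K sg br rhoL rhoR H K n f = (\<lambda>_. 0)}"

definition B_K ::
  "(complex \<Rightarrow> 'g::ab_group_add \<Rightarrow> 'g) \<Rightarrow> ('g \<Rightarrow> 'g \<Rightarrow> 'g) \<Rightarrow>
   (complex \<Rightarrow> 'v::ab_group_add \<Rightarrow> 'v) \<Rightarrow> ('g \<Rightarrow> 'v \<Rightarrow> 'v) \<Rightarrow> ('g \<Rightarrow> 'v \<Rightarrow> 'v) \<Rightarrow>
   ('g \<Rightarrow> 'g \<Rightarrow> 'v) \<Rightarrow> ('v \<Rightarrow> 'g) \<Rightarrow> nat \<Rightarrow> ('v list \<Rightarrow> 'g) set" where
  "B_K sg br sv rhoL rhoR H K n =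
     (case n of 0 \<Rightarrow> {\<lambda>_. 0}
      | Suc m \<Rightarrow> d_K sg br rhoL rhoR H K m ` cochains sv sg m)"

definition cohomologous_K ::
  "(complex \<Rightarrow> 'g::ab_group_add \<Rightarrow> 'g) \<Rightarrow> ('g \<Rightarrow> 'g \<Rightarrow> 'g) \<Rightarrow>
   (complex \<Rightarrow> 'v::ab_group_add \<Rightarrow> 'v) \<Rightarrow> ('g \<Rightarrow> 'v \<Rightarrow> 'v) \<Rightarrow> ('g \<Rightarrow> 'v \<Rightarrow> 'v) \<Rightarrow>
   ('g \<Rightarrow> 'g \<Rightarrow> 'v) \<Rightarrow> ('v \<Rightarrow> 'g) \<Rightarrow> nat \<Rightarrow> (('v list \<Rightarrow> 'g) \<times> ('v list \<Rightarrow> 'g)) set" where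
  "cohomologous_K sg br sv rhoL rhoR H K n =
     {(f, g). f \<in> Z_K sg br sv rhoL rhoR H K n \<and> g \<in> Z_K sg br sv rhoL rhoR H K n \<and>
              (\<lambda>us. f us - g us) \<in> B_K sg br sv rhoL rhoR H K n}"

definition H_K ::
  "(complex \<Rightarrow> 'g::ab_group_add \<Rightarrow> 'g) \<Rightarrow> ('g \<Rightarrow> 'g \<Rightarrow> 'g) \<Rightarrow>
   (complex \<Rightarrow> 'v::ab_group_add \<Rightarrow> 'v) \<Rightarrow> ('g \<Rightarrow> 'v \<Rightarrow> 'v) \<Rightarrow> ('g \<Rightarrow> 'v \<Rightarrow> 'v) \<Rightarrow>
   ('g \<Rightarrow> 'g \<Rightarrow> 'v) \<Rightarrow> ('v \<Rightarrow> 'g) \<Rightarrow> nat \<Rightarrow> ('v list \<Rightarrow> 'g) set set" where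
  "H_K sg br sv rhoL rhoR H K n =
     Z_K sg br sv rhoL rhoR H K n // cohomologous_K sg br sv rhoL rhoR H K n"

definition class_K ::
  "(complex \<Rightarrow> 'g::ab_group_add \<Rightarrow> 'g) \<Rightarrow> ('g \<Rightarrow> 'g \<Rightarrow> 'g) \<Rightarrow>
   (complex \<Rightarrow> 'v::ab_group_add \<Rightarrow> 'v) \<Rightarrow> ('g \<Rightarrow> 'v \<Rightarrow> 'v) \<Rightarrow> ('g \<Rightarrow> 'v \<Rightarrow> 'v) \<Rightarrow>
   ('g \<Rightarrow> 'g \<Rightarrow> 'v) \<Rightarrow> ('v \<Rightarrow> 'g) \<Rightarrow> nat \<Rightarrow> ('v list \<Rightarrow> 'g) \<Rightarrow> ('v list \<Rightarrow> 'g) set" where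
  "class_K sg br sv rhoL rhoR H K n f = cohomologous_K sg br sv rhoL rhoR H K n `` {f}"


section \<open>Formal deformations\<close>

text \<open>
  The \<open>\<complex>[[t]]\<close>-bilinear extension of a bilinear map to power series, by the Cauchy product.
  Evaluation of maps at vectors is itself bilinear, so a series of linear maps acts on series
  of vectors by \<open>fps_app\<close>, and this action is automatically \<open>\<complex>[[t]]\<close>-linear.
\<close>

definition fps_bil :: "('a \<Rightarrow> 'b \<Rightarrow> 'c::comm_monoid_add) \<Rightarrow> 'a fps \<Rightarrow> 'b fps \<Rightarrow> 'c fps" where
  "fps_bil b X Y = Abs_fps (\<lambda>n. \<Sum>i\<le>n. b (fps_nth X i) (fps_nth Y (n - i)))"

definition fps_app :: "('a \<Rightarrow> 'b::comm_monoid_add) fps \<Rightarrow> 'a fps \<Rightarrow> 'b fps" where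
  "fps_app = fps_bil (\<lambda>f x. f x)"

definition formal_deformation ::
  "(complex \<Rightarrow> 'g::ab_group_add \<Rightarrow> 'g) \<Rightarrow> ('g \<Rightarrow> 'g \<Rightarrow> 'g) \<Rightarrow>
   (complex \<Rightarrow> 'v::ab_group_add \<Rightarrow> 'v) \<Rightarrow> ('g \<Rightarrow> 'v \<Rightarrow> 'v) \<Rightarrow> ('g \<Rightarrow> 'v \<Rightarrow> 'v) \<Rightarrow>
   ('g \<Rightarrow> 'g \<Rightarrow> 'v) \<Rightarrow> ('v \<Rightarrow> 'g) \<Rightarrow> ('v \<Rightarrow> 'g) fps \<Rightarrow> bool" where
  "formal_deformation sg br sv rhoL rhoR H K Kt \<longleftrightarrow>
     (\<forall>i. Vector_Spaces.linear sv sg (fps_nth Kt i)) \<and>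
     fps_nth Kt 0 = K \<and>
     (\<forall>u v. let Ku = fps_app Kt (fps_const u); Kv = fps_app Kt (fps_const v) in
        fps_bil br Ku Kv =
        fps_app Kt (fps_bil rhoL Ku (fps_const v) + fps_bil rhoR Kv (fps_const u) + fps_bil H Ku Kv))"

text \<open>The infinitesimal, as a \<open>1\<close>-cochain.\<close>

definition infinitesimal :: "('v \<Rightarrow> 'g::zero) fps \<Rightarrow> 'v list \<Rightarrow> 'g" where
  "infinitesimal Kt = (\<lambda>us. case us of [u] \<Rightarrow> fps_nth Kt 1 u | _ \<Rightarrow> 0)"

definition fps_rb_morphism ::
  "('g \<Rightarrow> 'g \<Rightarrow> 'g::ab_group_add) \<Rightarrow>
   ('g \<Rightarrow> 'v::ab_group_add \<Rightarrow> 'v) \<Rightarrow> ('g \<Rightarrow> 'v \<Rightarrow> 'v) \<Rightarrow> ('g \<Rightarrow> 'g \<Rightarrow> 'v) \<Rightarrow>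
   ('v \<Rightarrow> 'g) fps \<Rightarrow> ('v \<Rightarrow> 'g) fps \<Rightarrow> ('g \<Rightarrow> 'g) fps \<Rightarrow> ('v \<Rightarrow> 'v) fps \<Rightarrow> bool" where
  "fps_rb_morphism br rhoL rhoR H Kt Kt' \<phi> \<psi> \<longleftrightarrow>
     (\<forall>X Y. fps_app \<phi> (fps_bil br X Y) = fps_bil br (fps_app \<phi> X) (fps_app \<phi> Y)) \<and>
     (\<forall>U. fps_app \<phi> (fps_app Kt U) = fps_app Kt' (fps_app \<psi> U)) \<and>
     (\<forall>y u. fps_app \<psi> (fps_const (rhoL y u)) =
            fps_bil rhoL (fps_app \<phi> (fps_const y)) (fps_app \<psi> (fps_const u))) \<and>
     (\<forall>y u. fps_app \<psi> (fps_const (rhoR y u)) =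
            fps_bil rhoR (fps_app \<phi> (fps_const y)) (fps_app \<psi> (fps_const u))) \<and>
     (\<forall>X Y. fps_app \<psi> (fps_bil H X Y) = fps_bil H (fps_app \<phi> X) (fps_app \<phi> Y))"

definition equivalent_deformations ::
  "(complex \<Rightarrow> 'g::ab_group_add \<Rightarrow> 'g) \<Rightarrow> ('g \<Rightarrow> 'g \<Rightarrow> 'g) \<Rightarrow>
   (complex \<Rightarrow> 'v::ab_group_add \<Rightarrow> 'v) \<Rightarrow> ('g \<Rightarrow> 'v \<Rightarrow> 'v) \<Rightarrow> ('g \<Rightarrow> 'v \<Rightarrow> 'v) \<Rightarrow>
   ('g \<Rightarrow> 'g \<Rightarrow> 'v) \<Rightarrow> ('v \<Rightarrow> 'g) \<Rightarrow> ('v \<Rightarrow> 'g) fps \<Rightarrow> ('v \<Rightarrow> 'g) fps \<Rightarrow> bool" where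
  "equivalent_deformations sg br sv rhoL rhoR H K Kt Kt' \<longleftrightarrow>
     (\<exists>x \<phi> \<psi>.
        fps_nth \<phi> 0 = id \<and> fps_nth \<phi> 1 = (\<lambda>y. br x y) \<and>
        (\<forall>i\<ge>2. Vector_Spaces.linear sg sg (fps_nth \<phi> i)) \<and>
        fps_nth \<psi> 0 = id \<and> fps_nth \<psi> 1 = (\<lambda>u. rhoL x u + H x (K u)) \<and>
        (\<forall>i\<ge>2. Vector_Spaces.linear sv sv (fps_nth \<psi> i)) \<and>
        fps_rb_morphism br rhoL rhoR H Kt Kt' \<phi> \<psi>)"

end

theory Submission
  imports Defs
begin

text \<open>
  The coefficient of \<open>t\<close> in the deformation equation is the identity \<open>\<partial>\<^sub>K K\<^sub>1 = 0\<close>. The coefficient of \<open>t\<close>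
  in \<open>\<phi>\<^sub>t \<circ> K\<^sub>t = K'\<^sub>t \<circ> \<psi>\<^sub>t\<close> is \<open>K\<^sub>1 u + [x, K u] = K'\<^sub>1 u + K (\<rho>\<^sup>L(x) u + H(x, K u))\<close>, that is,
  \<open>K\<^sub>1 - K'\<^sub>1 = \<partial>\<^sub>K x\<close>.
\<close>

lemma linear_map_diff: "Vector_Spaces.linear s1 s2 f \<Longrightarrow> f (x - y) = f x - f y"
  by (simp add: Vector_Spaces.linear_iff_module_hom module_hom.diff)

lemma linear_map_add: "Vector_Spaces.linear s1 s2 f \<Longrightarrow> f (x + y) = f x + f y"
  by (simp add: Vector_Spaces.linear_iff_module_hom module_hom.add)

lemma linear_map_0: "Vector_Spaces.linear s1 s2 f \<Longrightarrow> f 0 = 0"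
  by (simp add: Vector_Spaces.linear_iff_module_hom module_hom.zero)

lemma bilinear_map_zero:
  assumes "bilinear_map sA sB sC b"
  shows "b 0 y = 0" and "b x 0 = 0"
  using assms linear_map_0[of sA sC "\<lambda>x. b x y"] linear_map_0[of sB sC "\<lambda>y. b x y"]
  by (simp_all add: bilinear_map_def)

lemma bilinear_map_diff_left: "bilinear_map sA sB sC b \<Longrightarrow> b (x - x') y = b x y - b x' y"
  using linear_map_diff[of sA sC "\<lambda>x. b x y"] by (simp add: bilinear_map_def)

lemma bilinear_map_diff_right: "bilinear_map sA sB sC b \<Longrightarrow> b x (y - y') = b x y - b x y'"
  using linear_map_diff[of sB sC "\<lambda>y. b x y"] by (simp add: bilinear_map_def)

text \<open>Only the coefficients of \<open>1\<close> and \<open>t\<close> are compared below. The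
  index is written \<open>Suc 0\<close> because that is the simplifier's normal form of
  \<open>1\<close>.\<close>

lemma fps_bil_nth_0: "fps_nth (fps_bil b X Y) 0 = b (fps_nth X 0) (fps_nth Y 0)"
  by (simp add: fps_bil_def)

lemma fps_bil_nth_1:
  "fps_nth (fps_bil b X Y) (Suc 0) =
     b (fps_nth X 0) (fps_nth Y (Suc 0)) + b (fps_nth X (Suc 0)) (fps_nth Y 0)"
  by (simp add: fps_bil_def)

lemma fps_app_nth_0: "fps_nth (fps_app F X) 0 = fps_nth F 0 (fps_nth X 0)"
  by (simp add: fps_app_def fps_bil_nth_0)

lemma fps_app_nth_1:
  "fps_nth (fps_app F X) (Suc 0) =
     fps_nth F 0 (fps_nth X (Suc 0)) + fps_nth F (Suc 0) (fps_nth X 0)"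
  by (simp add: fps_app_def fps_bil_nth_1)

lemmas fps_bil_app_nth = fps_bil_nth_0 fps_bil_nth_1 fps_app_nth_0 fps_app_nth_1

text \<open>The differential is built from \<open>f\<close> by evaluation, the two actions and
  signs, so additivity of the actions in the module argument is enough, whatever \<open>f\<close>,
  \<open>g\<close> and \<open>brA\<close> are. This makes the coboundaries closed under
  differences.\<close>

lemma leibniz_d_diff:
  assumes "module sM"
    and "\<And>u x y. rL u (x - y) = rL u x - rL u y" and "\<And>u x y. rR u (x - y) = rR u x - rR u y"
  shows "leibniz_d sM brA rL rR n (\<lambda>us. f us - g us) =
    (\<lambda>us. leibniz_d sM brA rL rR n f us - leibniz_d sM brA rL rR n g us)"
  by (rule ext)
    (simp add: leibniz_d_def assms(2,3) module.scale_right_diff_distrib[OF assms(1)] sum_subtractf)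

lemma cochains_diff:
  assumes "vector_space_pair sA sM" "f \<in> cochains sA sM n" "g \<in> cochains sA sM n"
  shows "(\<lambda>us. f us - g us) \<in> cochains sA sM n"
  using assms(2,3) by (auto simp: cochains_def intro: vector_space_pair.linear_compose_sub[OF assms(1)])

context twisted_rota_baxter
begin

lemma rhoL_K_diff: "rhoL_K br rhoR H K u (x - y) = rhoL_K br rhoR H K u x - rhoL_K br rhoR H K u y"
  by (simp add: rhoL_K_def bilinear_map_diff_left[OF rhoR_bilinear] bilinear_map_diff_right[OF br_bilinear]
      bilinear_map_diff_right[OF H_bilinear] linear_map_diff[OF K_linear])

lemma rhoR_K_diff: "rhoR_K br rhoL H K u (x - y) = rhoR_K br rhoL H K u x - rhoR_K br rhoL H K u y"
  by (simp add: rhoR_K_def bilinear_map_diff_left[OF rhoL_bilinear] bilinear_map_diff_left[OF br_bilinear]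
      bilinear_map_diff_left[OF H_bilinear] linear_map_diff[OF K_linear])

text \<open>Closure under differences is the single subgroup property from which zero, negatives and
  sums of coboundaries are derived.\<close>

lemma B_K_diff:
  assumes "f \<in> B_K sg br sv rhoL rhoR H K n" "g \<in> B_K sg br sv rhoL rhoR H K n"
  shows "(\<lambda>us. f us - g us) \<in> B_K sg br sv rhoL rhoR H K n"
proof (cases n)
  case 0
  then show ?thesis using assms by (simp add: B_K_def)
next
  case (Suc m)
  obtain f' g' where f': "f' \<in> cochains sv sg m" "f = d_K sg br rhoL rhoR H K m f'"
    and g': "g' \<in> cochains sv sg m" "g = d_K sg br rhoL rhoR H K m g'"
    using assms Suc by (auto simp: B_K_def)
  have "vector_space_pair sv sg"
    by (intro vector_space_pair.intro V.vector_space_axioms vector_space_axioms)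
  then have "(\<lambda>us. f' us - g' us) \<in> cochains sv sg m"
    using f' g' by (blast intro: cochains_diff)
  moreover have "d_K sg br rhoL rhoR H K m (\<lambda>us. f' us - g' us) = (\<lambda>us. f us - g us)"
    unfolding d_K_def f' g' by (rule leibniz_d_diff[OF module_axioms rhoL_K_diff rhoR_K_diff])
  ultimately show ?thesis
    unfolding B_K_def Suc by (auto intro: rev_image_eqI)
qed

text \<open>On \<open>Z_K\<close> the relation is congruence modulo \<open>B_K\<close>, and
  \<open>B_K\<close> is nonempty and closed under differences. Hence related cocycles have equal
  classes.\<close>

lemma equiv_cohomologous_K:
  "equiv (Z_K sg br sv rhoL rhoR H K n) (cohomologous_K sg br sv rhoL rhoR H K n)"
proof -
  let ?B = "B_K sg br sv rhoL rhoR H K n"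
  have "(\<lambda>_. 0) \<in> cochains sv sg m" for m
    by (auto simp: cochains_def intro!: vector_space_pair.linear_zero
        vector_space_pair.intro V.vector_space_axioms vector_space_axioms)
  then have "?B \<noteq> {}"
    by (cases n) (auto simp: B_K_def)
  \<comment> \<open>Subtract any coboundary from itself.\<close>
  then have zero: "(\<lambda>_. 0) \<in> ?B"
    using B_K_diff by fastforce
  have neg: "(\<lambda>us. g us - f us) \<in> ?B" if "(\<lambda>us. f us - g us) \<in> ?B" for f g
    using B_K_diff[OF zero that] by simp
  \<comment> \<open>Here \<open>f - h\<close> is written as
    \<open>(f - g) - (h - g)\<close>.\<close>
  have trans: "(\<lambda>us. f us - h us) \<in> ?B"
    if "(\<lambda>us. f us - g us) \<in> ?B" "(\<lambda>us. g us - h us) \<in> ?B" for f g h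
    using B_K_diff[OF that(1) neg[OF that(2)]] by simp
  show ?thesis
  proof (rule equivI)
    show "refl_on (Z_K sg br sv rhoL rhoR H K n) (cohomologous_K sg br sv rhoL rhoR H K n)"
      using zero by (simp add: refl_on_def cohomologous_K_def)
    show "sym (cohomologous_K sg br sv rhoL rhoR H K n)"
      by (rule symI) (simp add: cohomologous_K_def neg)
    show "trans (cohomologous_K sg br sv rhoL rhoR H K n)"
      by (rule transI) (use trans in \<open>unfold cohomologous_K_def, blast\<close>)
  qed (auto simp: cohomologous_K_def)
qed

text \<open>At \<open>[u, v]\<close> the differential is
  \<open>rhoL_K u (K1 v) + rhoR_K v (K1 u) - K1 [u, v]_K\<close>. Once the two actions are expanded,
  its vanishing is the deformation equation in degree one.\<close>

lemma infinitesimal_cocycle: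
  assumes "formal_deformation sg br sv rhoL rhoR H K Kt"
  shows "infinitesimal Kt \<in> Z_K sg br sv rhoL rhoR H K 1"
proof -
  let ?K1 = "fps_nth Kt 1"
  have lin: "Vector_Spaces.linear sv sg ?K1" and K0: "fps_nth Kt 0 = K"
    and eq: "fps_bil br (fps_app Kt (fps_const u)) (fps_app Kt (fps_const v)) =
      fps_app Kt (fps_bil rhoL (fps_app Kt (fps_const u)) (fps_const v) +
        fps_bil rhoR (fps_app Kt (fps_const v)) (fps_const u) +
        fps_bil H (fps_app Kt (fps_const u)) (fps_app Kt (fps_const v)))" for u v
    using assms unfolding formal_deformation_def Let_def by blast+
  \<comment> \<open>On the right, \<open>K\<close> meets the coefficient of \<open>t\<close> of the
    argument and \<open>K1\<close> its constant coefficient, which is the bracket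
    \<open>br_K\<close>. The terms containing the coefficient of \<open>t\<close> of the constant
    series \<open>u\<close> or \<open>v\<close> vanish.\<close>
  have first_order: "br (K u) (?K1 v) + br (?K1 u) (K v) =
      K (rhoL (?K1 u) v) + K (rhoR (?K1 v) u) + K (H (K u) (?K1 v)) + K (H (?K1 u) (K v))
      + ?K1 (br_K rhoL rhoR H K u v)" for u v
    using arg_cong[OF eq[of u v], of "\<lambda>F. fps_nth F (Suc 0)"]
    by (simp add: fps_bil_app_nth K0 br_K_def linear_map_add[OF K_linear] linear_map_0[OF K_linear]
        bilinear_map_zero[OF rhoL_bilinear] bilinear_map_zero[OF rhoR_bilinear] add.assoc)
  \<comment> \<open>Cochains are functions on all lists, so lengths other than 2 are treated as
    well; there the differential is \<open>0\<close> by default.\<close>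
  have "d_K sg br rhoL rhoR H K 1 (infinitesimal Kt) us = 0" for us
  proof (cases "length us = 2")
    case True
    then obtain u v where us: "us = [u, v]"
      by (auto simp: length_Suc_conv numeral_2_eq_2)
    show ?thesis
      using first_order[of u v]
      by (simp add: us d_K_def leibniz_d_def omit_def infinitesimal_def rhoL_K_def rhoR_K_def
          atMost_Suc algebra_simps)
  qed (simp add: d_K_def leibniz_d_def)
  moreover have "infinitesimal Kt \<in> cochains sv sg 1"
    using lin by (auto simp: cochains_def infinitesimal_def length_Suc_conv split: list.split)
  ultimately show ?thesis
    by (auto simp: Z_K_def)
qed

lemma infinitesimal_diff_coboundary:
  assumes Kt: "fps_nth Kt 0 = K" and Kt': "fps_nth Kt' 0 = K"
    and equi: "equivalent_deformations sg br sv rhoL rhoR H K Kt Kt'"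
  shows "(\<lambda>us. infinitesimal Kt us - infinitesimal Kt' us) \<in> B_K sg br sv rhoL rhoR H K 1"
proof -
  obtain x \<phi> \<psi> where \<phi>: "fps_nth \<phi> 0 = id" "fps_nth \<phi> 1 = (\<lambda>y. br x y)"
    and \<psi>: "fps_nth \<psi> 0 = id" "fps_nth \<psi> 1 = (\<lambda>u. rhoL x u + H x (K u))"
    and "fps_rb_morphism br rhoL rhoR H Kt Kt' \<phi> \<psi>"
    using equi unfolding equivalent_deformations_def by blast
  then have "fps_app \<phi> (fps_app Kt (fps_const u)) = fps_app Kt' (fps_app \<psi> (fps_const u))" for u
    by (simp add: fps_rb_morphism_def)
  \<comment> \<open>On the left, \<open>\<phi>\<close> contributes \<open>[x, K u]\<close>; on the
    right, \<open>K\<close> is applied to the coefficient of \<open>t\<close> in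
    \<open>\<psi>\<close>, which gives the terms in \<open>rhoL\<close> and
    \<open>H\<close>.\<close>
  from arg_cong[OF this, of "\<lambda>F. fps_nth F (Suc 0)"]
  have first_order: "fps_nth Kt 1 u + br x (K u) = K (rhoL x u) + K (H x (K u)) + fps_nth Kt' 1 u" for u
    using \<phi> \<psi> by (simp add: fps_bil_app_nth Kt Kt' linear_map_add[OF K_linear] linear_map_0[OF K_linear])
  \<comment> \<open>The element \<open>x\<close> of the equivalence, as a 0-cochain: its value sits
    at the empty list. The differential in degree 0 is \<open>- rhoR_K u x\<close>, whose sign
    matches \<open>K1 - K1'\<close> in this order.\<close>
  define f where "f us = (if us = [] then x else 0)" for us :: "'v list"
  have "f \<in> cochains sv sg 0"
    by (simp add: cochains_def f_def)
  moreover have "infinitesimal Kt us - infinitesimal Kt' us = d_K sg br rhoL rhoR H K 0 f us" for us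
  proof (cases "length us = 1")
    case True
    then obtain u where us: "us = [u]"
      by (auto simp: length_Suc_conv)
    show ?thesis
      using first_order[of u]
      by (simp add: us d_K_def leibniz_d_def omit_def infinitesimal_def rhoR_K_def f_def algebra_simps)
  qed (auto simp: d_K_def leibniz_d_def infinitesimal_def split: list.split)
  ultimately show ?thesis
    by (auto simp: B_K_def intro: rev_image_eqI)
qed

end

theorem theorem4p11:
  fixes sg :: "complex \<Rightarrow> 'g::ab_group_add \<Rightarrow> 'g" and basisG :: "'g set"
    and br :: "'g \<Rightarrow> 'g \<Rightarrow> 'g"
    and sv :: "complex \<Rightarrow> 'v::ab_group_add \<Rightarrow> 'v" and basisV :: "'v set"
    and rhoL rhoR :: "'g \<Rightarrow> 'v \<Rightarrow> 'v"
    and H :: "'g \<Rightarrow> 'g \<Rightarrow> 'v" and K :: "'v \<Rightarrow> 'g"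
  assumes "twisted_rota_baxter sg basisG br sv basisV rhoL rhoR H K"
  shows "(\<forall>Kt. formal_deformation sg br sv rhoL rhoR H K Kt \<longrightarrow>
            infinitesimal Kt \<in> Z_K sg br sv rhoL rhoR H K 1 \<and>
            class_K sg br sv rhoL rhoR H K 1 (infinitesimal Kt) \<in> H_K sg br sv rhoL rhoR H K 1) \<and>
         (\<forall>Kt Kt'. formal_deformation sg br sv rhoL rhoR H K Kt \<and>
            formal_deformation sg br sv rhoL rhoR H K Kt' \<and>
            equivalent_deformations sg br sv rhoL rhoR H K Kt Kt' \<longrightarrow>
            class_K sg br sv rhoL rhoR H K 1 (infinitesimal Kt) =
            class_K sg br sv rhoL rhoR H K 1 (infinitesimal Kt'))"
proof -
  interpret twisted_rota_baxter sg basisG br sv basisV rhoL rhoR H K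
    by (fact assms)
  show ?thesis
  proof (intro conjI allI impI; (elim conjE)?)
    fix Kt
    assume "formal_deformation sg br sv rhoL rhoR H K Kt"
    then show "infinitesimal Kt \<in> Z_K sg br sv rhoL rhoR H K 1"
      by (rule infinitesimal_cocycle)
    then show "class_K sg br sv rhoL rhoR H K 1 (infinitesimal Kt) \<in> H_K sg br sv rhoL rhoR H K 1"
      unfolding class_K_def H_K_def by (rule quotientI)
  next
    fix Kt Kt'
    assume def: "formal_deformation sg br sv rhoL rhoR H K Kt"
        "formal_deformation sg br sv rhoL rhoR H K Kt'"
      and "equivalent_deformations sg br sv rhoL rhoR H K Kt Kt'"
    then have "(\<lambda>us. infinitesimal Kt us - infinitesimal Kt' us) \<in> B_K sg br sv rhoL rhoR H K 1"
      by (intro infinitesimal_diff_coboundary) (simp_all add: formal_deformation_def)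
    \<comment> \<open>The relation also asks that both infinitesimals be cocycles, which the first
      half of the theorem supplies.\<close>
    then have "(infinitesimal Kt, infinitesimal Kt') \<in> cohomologous_K sg br sv rhoL rhoR H K 1"
      using def[THEN infinitesimal_cocycle] by (simp add: cohomologous_K_def)
    then show "class_K sg br sv rhoL rhoR H K 1 (infinitesimal Kt) =
        class_K sg br sv rhoL rhoR H K 1 (infinitesimal Kt')"
      unfolding class_K_def by (rule equiv_class_eq[OF equiv_cohomologous_K])
  qed
qed

end
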